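(* Let $(Y_i, \boldsymbol{X}_i)_{i \geq 1}$ be i.i.d. random vectors with the law of a pair $(Y, \boldsymbol{X})$, and for $n \geq 2$ let $\mathcal{T} = (Y_i, \boldsymbol{X}_i)_{1 \leq i \leq n}$ be the test set of size $n = |\mathcal{T}|$. Let $\mathcal{B} = (Y_i, \boldsymbol{X}_i)_{i \in \mathfrak{B}}$ (indexed by a finite set $\mathfrak{B}$ disjoint from $\{1,2,\dots\}$, of fixed size not depending on $n$) be a set of i.i.d. random vectors that is independent of the test data $(Y_i,\boldsymbol{X}_i)_{i\ge 1}$; the pair $(Y,\boldsymbol{X})$ is independent of the test data and of $\mathcal{B}$. Let $\widehat{\mu}_\ell : \mathcal{X} \to \mathbb{R}$ be a (deterministic) measurable function with image $\widehat{\mu}_\ell(\mathcal{X}) = \{\widehat{\mu}_\ell(\boldsymbol{x}) : \boldsymbol{x} \in \mathcal{X}\}$, and let $h_{\ell,\mathcal{B}} : \widehat{\mu}_\ell(\mathcal{X}) \to \mathbb{R}$ be a $\sigma(\mathcal{B})$-measurable (random) function. Then the random variables $$Z_i = (Y_i - \widehat{\mu}_\ell(\boldsymbol{X}_i))\, h_{\ell,\mathcal{B}}(\widehat{\mu}_\ell(\boldsymbol{X}_i)), \quad 1 \leq i \leq n,$$ are conditionally i.i.d. given $\mathcal{B}$. If, in addition, $$0 < \mathrm{Var}(Z_i \mid \mathcal{B}) < \infty, \quad \mathbb{P}\text{-a.s.},$$ then, under the null hypothesis that $\widehat{\mu}_\ell$ is auto-calibrated for $(Y, \boldsymbol{X})$,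 $$T_n^{\mathrm{ac}} = \frac{\bar{Z}}{\sqrt{S_Z^2/n}} \stackrel{d}{\longrightarrow} \mathcal{N}(0,1) \quad \text{as } n = |\mathcal{T}| \to \infty,$$ where $$\bar{Z} = \frac{1}{n}\sum_{i=1}^n Z_i \quad \text{and} \quad S_Z^2 = \frac{1}{n-1}\sum_{i=1}^n (Z_i - \bar{Z})^2.$$
   Context: All random variables are defined on a probability space $(\Omega, \mathcal{F}, \mathbb{P})$. $Y$ is a real-valued square-integrable response, and $\boldsymbol{X}$ is a random vector of features taking values in a measurable feature space $\mathcal{X}$. The subscript $\ell$ refers to a fixed (non-random) set of learning data on which $\widehat{\mu}_\ell$ and $h_{\ell,\mathcal{B}}$ may depend; it plays no probabilistic role. Auto-calibration: a measurable function $\widehat{\mu}: \mathcal{X} \to \mathbb{R}$ is auto-calibrated for $(Y, \boldsymbol{X})$ if $\widehat{\mu}(\boldsymbol{X}) = \mathbb{E}[Y \mid \widehat{\mu}(\boldsymbol{X})]$, $\mathbb{P}$-a.s. That $h_{\ell,\mathcal{B}}$ is a $\sigma(\mathcal{B})$-measurable function means that it is a random function determined by $\mathcal{B}$: there is a jointly measurable real-valued map $(\boldsymbol{b}, m) \mapsto h_{\ell,\boldsymbol{b}}(m)$, with $\boldsymbol{b}$ ranging over the possible values of $\mathcal{B}$ and $m \in \widehat{\mu}_\ell(\mathcal{X})$ (equipped with the trace of the Borel $\sigma$-algebra of $\mathbb{R}$), and $h_{\ell,\mathcal{B}}(m)$ is its value at $\boldsymbol{b} = \mathcal{B}$. $\mathrm{Var}(Z_i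 \mid \mathcal{B})$ is the variance of $Z_i$ under its conditional distribution given $\mathcal{B}$; its finiteness means that this conditional distribution has finite second moment. On the event $\{S_Z^2 = 0\}$, $T_n^{\mathrm{ac}}$ may be assigned an arbitrary value, e.g. $0$. *)

theory Defs
  imports "HOL-Probability.Probability"
begin

definition sigma_gen :: "'a measure \<Rightarrow> 'b measure \<Rightarrow> ('a \<Rightarrow> 'b) \<Rightarrow> 'a measure" where
  "sigma_gen M N X = vimage_algebra (space M) X N"

text \<open>The library's \<open>indep_var\<close> forces both random variables to have the same value type;
  this is the same notion for two different value types.\<close>

definition indep_rv ::
  "'a measure \<Rightarrow> 'b measure \<Rightarrow> ('a \<Rightarrow> 'b) \<Rightarrow> 'c measure \<Rightarrow> ('a \<Rightarrow> 'c) \<Rightarrow> bool" where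
  "indep_rv M N X N' X' \<longleftrightarrow>
     X \<in> measurable M N \<and> X' \<in> measurable M N' \<and>
     prob_space.indep_set M (sets (sigma_gen M N X)) (sets (sigma_gen M N' X'))"

definition auto_calibrated ::
  "'a measure \<Rightarrow> 'x measure \<Rightarrow> ('x \<Rightarrow> real) \<Rightarrow> ('a \<Rightarrow> real) \<Rightarrow> ('a \<Rightarrow> 'x) \<Rightarrow> bool" where
  "auto_calibrated M N \<mu> Y X \<longleftrightarrow>
     \<mu> \<in> borel_measurable N \<and>
     (AE \<omega> in M. \<mu> (X \<omega>) = real_cond_exp M (sigma_gen M borel (\<lambda>\<omega>. \<mu> (X \<omega>))) Y \<omega>)"

definition cond_prob :: "'a measure \<Rightarrow> 'a measure \<Rightarrow> 'a set \<Rightarrow> 'a \<Rightarrow> real" where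
  "cond_prob M F A = real_cond_exp M F (indicator A)"

definition cond_indep_vars ::
  "'a measure \<Rightarrow> 'a measure \<Rightarrow> 'i set \<Rightarrow> ('i \<Rightarrow> 'a \<Rightarrow> real) \<Rightarrow> bool" where
  "cond_indep_vars M F I Z \<longleftrightarrow>
     (\<forall>i\<in>I. Z i \<in> borel_measurable M) \<and>
     (\<forall>J A. J \<subseteq> I \<and> finite J \<and> (\<forall>i\<in>J. A i \<in> sets borel) \<longrightarrow>
        (AE \<omega> in M. cond_prob M F {\<omega> \<in> space M. \<forall>i\<in>J. Z i \<omega> \<in> A i} \<omega> =
           (\<Prod>i\<in>J. cond_prob M F {\<omega> \<in> space M. Z i \<omega> \<in> A i} \<omega>)))"

definition cond_ident_distr ::
  "'a measure \<Rightarrow> 'a measure \<Rightarrow> 'i set \<Rightarrow> ('i \<Rightarrow> 'a \<Rightarrow> real) \<Rightarrow> bool" where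
  "cond_ident_distr M F I Z \<longleftrightarrow>
     (\<forall>i\<in>I. \<forall>j\<in>I. \<forall>A\<in>sets borel.
        AE \<omega> in M. cond_prob M F {\<omega> \<in> space M. Z i \<omega> \<in> A} \<omega> =
                   cond_prob M F {\<omega> \<in> space M. Z j \<omega> \<in> A} \<omega>)"

definition cond_iid ::
  "'a measure \<Rightarrow> 'a measure \<Rightarrow> 'i set \<Rightarrow> ('i \<Rightarrow> 'a \<Rightarrow> real) \<Rightarrow> bool" where
  "cond_iid M F I Z \<longleftrightarrow> cond_indep_vars M F I Z \<and> cond_ident_distr M F I Z"

text \<open>\<open>K\<close> is a regular conditional distribution of the real random variable \<open>Z\<close> given \<open>F\<close>.\<close>

definition is_cond_distr ::
  "'a measure \<Rightarrow> 'a measure \<Rightarrow> ('a \<Rightarrow> real) \<Rightarrow> ('a \<Rightarrow> real measure) \<Rightarrow> bool" where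
  "is_cond_distr M F Z K \<longleftrightarrow>
     K \<in> measurable F (prob_algebra borel) \<and>
     (\<forall>A\<in>sets borel. AE \<omega> in M. measure (K \<omega>) A = cond_prob M F {\<omega> \<in> space M. Z \<omega> \<in> A} \<omega>)"

text \<open>A version of the conditional distribution; for real random variables it exists and is
  unique up to null sets, so the choice is immaterial in almost sure statements.\<close>

definition cond_distr :: "'a measure \<Rightarrow> 'a measure \<Rightarrow> ('a \<Rightarrow> real) \<Rightarrow> 'a \<Rightarrow> real measure" where
  "cond_distr M F Z = (SOME K. is_cond_distr M F Z K)"

text \<open>The variance under the conditional distribution, with values in \<open>[0,\<infinity>]\<close>. It is finite
  exactly if the second moment is: if the mean does not exist, the Bochner integral is 0 and the
  outer integral is infinite.\<close>

definition cond_variance :: "'a measure \<Rightarrow> 'a measure \<Rightarrow> ('a \<Rightarrow> real) \<Rightarrow> 'a \<Rightarrow> ennreal" where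
  "cond_variance M F Z \<omega> =
     (\<integral>\<^sup>+ z. ennreal ((z - (\<integral>u. u \<partial>cond_distr M F Z \<omega>))\<^sup>2) \<partial>cond_distr M F Z \<omega>)"

definition sample_mean :: "(nat \<Rightarrow> 'a \<Rightarrow> real) \<Rightarrow> nat \<Rightarrow> 'a \<Rightarrow> real" where
  "sample_mean Z n \<omega> = (\<Sum>i=1..n. Z i \<omega>) / real n"

definition sample_var :: "(nat \<Rightarrow> 'a \<Rightarrow> real) \<Rightarrow> nat \<Rightarrow> 'a \<Rightarrow> real" where
  "sample_var Z n \<omega> = (\<Sum>i=1..n. (Z i \<omega> - sample_mean Z n \<omega>)\<^sup>2) / (real n - 1)"

text \<open>\<open>c\<close> is the arbitrary value assigned where the sample variance vanishes.\<close>

definition T_ac :: "real \<Rightarrow> (nat \<Rightarrow> 'a \<Rightarrow> real) \<Rightarrow> nat \<Rightarrow> 'a \<Rightarrow> real" where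
  "T_ac c Z n \<omega> =
     (if sample_var Z n \<omega> = 0 then c
      else sample_mean Z n \<omega> / sqrt (sample_var Z n \<omega> / real n))"

end

theory Submission imports Defs begin

text \<open>Condition on \<open>B\<close>. Because the test data are independent of \<open>B\<close>, conditional probabilities given \<open>B\<close>
  are obtained by freezing \<open>B\<close> at its value \<open>b\<close>; the \<open>Z i\<close> then become i.i.d. functions
  of the test pairs. Auto-calibration makes the residual \<open>Y - \<mu> X\<close> orthogonal to functions of
  \<open>\<mu> X\<close>, so the frozen \<open>Z i\<close> are centred, and the studentized central limit theorem (central limit
  theorem, weak law of large numbers for the sample variance, Slutsky) applies for almost every \<open>b\<close>.
  Its limit does not depend on \<open>b\<close>, so dominated convergence for the mixture of the conditional
  distribution functions gives the unconditional limit.\<close>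

section \<open>Weak law of large numbers and Slutsky's theorem\<close>

lemma (in prob_space) indep_vars_reindex:
  assumes ind: "indep_vars M' X I" and inj: "inj_on f K" and fK: "f ` K \<subseteq> I"
  shows "indep_vars (\<lambda>k. M' (f k)) (\<lambda>k. X (f k)) K"
  unfolding indep_vars_def2 indep_sets_def
proof (intro conjI ballI allI impI)
  fix k assume "k \<in> K"
  with ind fK show "random_variable (M' (f k)) (X (f k))"
    and "{X (f k) -` A \<inter> space M |A. A \<in> sets (M' (f k))} \<subseteq> events"
    unfolding indep_vars_def2 by (auto intro!: measurable_sets)
next
  fix L A
  assume L: "L \<subseteq> K" "L \<noteq> {}" "finite L"
    and A: "A \<in> (\<Pi> j\<in>L. {X (f j) -` A \<inter> space M |A. A \<in> sets (M' (f j))})"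
  have injL: "inj_on f L" using inj L by (rule_tac inj_on_subset)
  \<comment> \<open>The sets \<open>A\<close> are indexed by \<open>L\<close>, while independence is
    given over \<open>I\<close>. The inverse \<open>?g\<close> carries them to the image of
    \<open>L\<close> under \<open>f\<close>.\<close>
  let ?g = "the_inv_into L f"
  have g: "?g (f l) = l" if "l \<in> L" for l using the_inv_into_f_f[OF injL that] .
  have "prob (\<Inter>i\<in>f ` L. A (?g i)) = (\<Prod>i\<in>f ` L. prob (A (?g i)))"
    by (rule indep_setsD[where I=I and F="\<lambda>i. {X i -` A \<inter> space M |A. A \<in> sets (M' i)}"])
      (use ind L fK A g in \<open>auto simp: indep_vars_def2\<close>)
  then show "prob (\<Inter>j\<in>L. A j) = (\<Prod>j\<in>L. prob (A j))"
    using g by (simp add: prod.reindex[OF injL] image_image cong: INF_cong)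
qed

text \<open>Only a first moment is assumed, because the law is later applied to squares of variables
  whose fourth moment may be infinite; Chebyshev's inequality would not do. Instead, the
  characteristic functions of the centred averages tend to 1, so by Levy continuity their laws tend
  to the point mass at 0, which is convergence in probability.\<close>

theorem (in prob_space) weak_law_of_large_numbers:
  fixes X :: "nat \<Rightarrow> 'a \<Rightarrow> real"
  assumes indep: "indep_vars (\<lambda>_. borel) X UNIV"
    and distrib: "\<And>n. distr M borel (X n) = \<nu>"
    and int: "integrable M (X 0)"
    and e: "0 < e"
  shows "(\<lambda>n. prob {\<omega>\<in>space M. e \<le> \<bar>(\<Sum>i<n. X i \<omega>) / real n - expectation (X 0)\<bar>}) \<longlonglongrightarrow> 0"
proof -
  define m where "m = expectation (X 0)"
  define X' where "X' i \<omega> = X i \<omega> - m" for i \<omega>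
  define S where "S n \<omega> = (\<Sum>i<n. X' i \<omega> / real n)" for n \<omega>
  have X[measurable]: "random_variable borel (X n)" for n
    using indep unfolding indep_vars_def2 by simp
  have X'[measurable]: "random_variable borel (X' n)" for n
    unfolding X'_def by simp
  have S[measurable]: "random_variable borel (S n)" for n
    unfolding S_def by simp
  define \<nu>' where "\<nu>' = distr M borel (X' 0)"
  have dX': "distr M borel (X' n) = \<nu>'" for n
  proof -
    have "distr M borel (X' n) = distr (distr M borel (X n)) borel (\<lambda>x. x - m)" for n
      by (subst distr_distr) (auto simp: X'_def[abs_def] comp_def)
    then show ?thesis unfolding \<nu>'_def by (simp add: distrib)
  qed
  interpret N: real_distribution \<nu>'
    unfolding \<nu>'_def by simp
  have intN: "integrable \<nu>' (\<lambda>x. x)" and expN: "N.expectation (\<lambda>x. x) = 0"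
    unfolding \<nu>'_def using int
    by (simp_all add: integrable_distr_eq integral_distr) (simp_all add: X'_def m_def prob_space)
  have intN_pow: "integrable \<nu>' (\<lambda>x. x ^ k)" if "k \<le> 1" for k
    using intN that by (cases "k = 0") (auto simp: le_Suc_eq)
  \<comment> \<open>First-order Taylor remainder, the linear term vanishing since the mean is 0. The
    minimum matters: its branch \<open>4 * \<bar>x\<bar>\<close> is an integrable majorant, and its
    other branch tends to 0 with \<open>s\<close>.\<close>
  have bound: "cmod (char \<nu>' s - 1) \<le> \<bar>s\<bar> / 2 * N.expectation (\<lambda>x. min (4 * \<bar>x\<bar>) (\<bar>s\<bar> * x\<^sup>2))" for s
    using N.char_approx2[of 1 s, OF intN_pow] N.prob_space
    by (simp add: expN numeral_2_eq_2 mult.commute[of _ 4])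
  have char_S: "char (distr M borel (S n)) t = (char \<nu>' (t / real n)) ^ n" for n t
  proof -
    have "char (distr M borel (S n)) t = (\<Prod>i<n. char (distr M borel (\<lambda>\<omega>. X' i \<omega> / real n)) t)"
      unfolding S_def
    proof (rule char_distr_sum)
      show "indep_vars (\<lambda>i. borel) (\<lambda>i \<omega>. X' i \<omega> / real n) {..<n}"
        unfolding X'_def
        by (rule indep_vars_compose2[where X=X, OF indep_vars_subset[OF indep]]) auto
    qed
    also have "\<dots> = (\<Prod>i<n. char \<nu>' (t / real n))"
    proof (rule prod.cong[OF refl])
      fix i
      show "char (distr M borel (\<lambda>\<omega>. X' i \<omega> / real n)) t = char \<nu>' (t / real n)"
        unfolding char_def dX'[of i, symmetric] by (simp add: integral_distr)
    qed
    finally show ?thesis by simp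
  qed
  have "weak_conv_m (\<lambda>n. distr M borel (S n)) (return borel 0)"
  proof (rule levy_continuity)
    show "real_distribution (return borel (0::real))"
      by (auto simp: real_distribution_def real_distribution_axioms_def intro!: prob_space_return)
    fix t :: real
    have "(\<lambda>n. N.expectation (\<lambda>x. min (4 * \<bar>x\<bar>) (\<bar>t / real n\<bar> * x\<^sup>2))) \<longlonglongrightarrow> N.expectation (\<lambda>x. 0)"
    proof (rule integral_dominated_convergence[where w="\<lambda>x. 4 * \<bar>x\<bar>"])
      show "integrable \<nu>' (\<lambda>x. 4 * \<bar>x\<bar>)" using intN by simp
      have "(\<lambda>n. min (4 * \<bar>x\<bar>) (\<bar>t / real n\<bar> * x\<^sup>2)) \<longlonglongrightarrow> min (4 * \<bar>x\<bar>) (0 * x\<^sup>2)" for x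
        by (intro tendsto_intros tendsto_rabs_zero lim_const_over_n)
      then show "AE x in \<nu>'. (\<lambda>n. min (4 * \<bar>x\<bar>) (\<bar>t / real n\<bar> * x\<^sup>2)) \<longlonglongrightarrow> 0"
        by (simp add: min_absorb2)
    qed auto
    then have lim: "(\<lambda>n. \<bar>t\<bar> / 2 * N.expectation (\<lambda>x. min (4 * \<bar>x\<bar>) (\<bar>t / real n\<bar> * x\<^sup>2))) \<longlonglongrightarrow> 0"
      by (simp add: tendsto_mult_right_zero)
    have "(\<lambda>n. char (distr M borel (S n)) t - 1) \<longlonglongrightarrow> 0"
    proof (rule Lim_null_comparison[OF _ lim])
      show "\<forall>\<^sub>F n in sequentially. cmod (char (distr M borel (S n)) t - 1)
          \<le> \<bar>t\<bar> / 2 * N.expectation (\<lambda>x. min (4 * \<bar>x\<bar>) (\<bar>t / real n\<bar> * x\<^sup>2))"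
        using eventually_gt_at_top[of 0]
      proof eventually_elim
        case (elim n)
        \<comment> \<open>The factor \<open>n\<close> lost in comparing the \<open>n\<close>-th
          powers cancels against the \<open>1 / n\<close> in \<open>t / real n\<close>, which leaves
          the vanishing expectation.\<close>
        have "cmod ((char \<nu>' (t / real n)) ^ n - 1 ^ n) \<le> n * cmod (char \<nu>' (t / real n) - 1)"
          by (rule norm_power_diff) (auto intro: N.cmod_char_le_1)
        also have "\<dots> \<le> n * (\<bar>t / real n\<bar> / 2 * N.expectation (\<lambda>x. min (4 * \<bar>x\<bar>) (\<bar>t / real n\<bar> * x\<^sup>2)))"
          by (intro mult_left_mono bound) simp
        also have "\<dots> = \<bar>t\<bar> / 2 * N.expectation (\<lambda>x. min (4 * \<bar>x\<bar>) (\<bar>t / real n\<bar> * x\<^sup>2))"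
          using elim by (simp add: abs_divide)
        finally show ?case by (simp add: char_S)
      qed
    qed
    then show "(\<lambda>n. char (distr M borel (S n)) t) \<longlonglongrightarrow> char (return borel 0) t"
      by (subst (asm) Lim_null[symmetric]) (simp add: char_def integral_return)
  qed simp
  then have cdf_lim: "(\<lambda>n. cdf (distr M borel (S n)) x) \<longlonglongrightarrow> cdf (return borel 0) x" if "x \<noteq> 0" for x
  proof -
    interpret R: real_distribution "return borel (0::real)"
      by (auto simp: real_distribution_def real_distribution_axioms_def intro!: prob_space_return)
    have "isCont (cdf (return borel 0)) x"
      unfolding R.isCont_cdf using that by (simp add: measure_return)
    then show ?thesis
      using \<open>weak_conv_m _ _\<close> unfolding weak_conv_m_def weak_conv_def by blast
  qed
  \<comment> \<open>Both points avoid 0, the only discontinuity of the limit. The right one is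
    \<open>e / 2\<close> instead of \<open>e\<close>, so that the strict event that
    \<open>S n\<close> exceeds it contains the event that \<open>S n\<close> is at least
    \<open>e\<close>.\<close>
  have "(\<lambda>n. cdf (distr M borel (S n)) (- e) + (1 - cdf (distr M borel (S n)) (e / 2))) \<longlonglongrightarrow> 0 + (1 - 1)"
    using cdf_lim[of "-e"] cdf_lim[of "e/2"] e
    by (intro tendsto_intros) (simp_all add: cdf_def measure_return)
  then have up: "(\<lambda>n. cdf (distr M borel (S n)) (- e) + (1 - cdf (distr M borel (S n)) (e / 2))) \<longlonglongrightarrow> 0"
    by simp
  show ?thesis
    unfolding m_def[symmetric]
  proof (rule tendsto_sandwich[OF _ _ tendsto_const up])
    show "\<forall>\<^sub>F n in sequentially. prob {\<omega> \<in> space M. e \<le> \<bar>(\<Sum>i<n. X i \<omega>) / real n - m\<bar>}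
      \<le> cdf (distr M borel (S n)) (- e) + (1 - cdf (distr M borel (S n)) (e / 2))"
      using eventually_gt_at_top[of 0]
    proof eventually_elim
      case (elim n)
      have eq: "(\<Sum>i<n. X i \<omega>) / real n - m = S n \<omega>" for \<omega>
        using elim by (simp add: S_def X'_def sum_subtractf diff_divide_distrib sum_divide_distrib[symmetric])
      have "prob {\<omega> \<in> space M. e \<le> \<bar>S n \<omega>\<bar>}
          \<le> prob ({\<omega> \<in> space M. S n \<omega> \<le> - e} \<union> {\<omega> \<in> space M. \<not> S n \<omega> \<le> e / 2})"
        using e by (intro finite_measure_mono) auto
      also have "\<dots> \<le> prob {\<omega> \<in> space M. S n \<omega> \<le> - e} + prob {\<omega> \<in> space M. \<not> S n \<omega> \<le> e / 2}"
        by (intro measure_Un_le) auto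
      also have "prob {\<omega> \<in> space M. \<not> S n \<omega> \<le> e / 2} = 1 - prob {\<omega> \<in> space M. S n \<omega> \<le> e / 2}"
        by (rule prob_neg) simp
      finally show ?case
        unfolding eq cdf_def by (simp add: measure_distr vimage_def Collect_conj_eq Int_commute)
    qed
  qed simp
qed

text \<open>Where \<open>R n\<close> is within \<delta> of 1, \<open>T n \<le> x\<close> means
  \<open>U n \<le> x * R n\<close>, and \<open>x * R n\<close> is within
  \<open>\<delta> * \<bar>x\<bar>\<close> of \<open>x\<close>. Hence the distribution function of
  \<open>T n\<close> at \<open>x\<close> lies between two nearby values of that of
  \<open>U n\<close>, up to a vanishing probability. The quotient formula is demanded only where
  \<open>R n\<close> is positive, which leaves room for an arbitrary value elsewhere.\<close>

lemma (in prob_space) slutsky_divide: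
  fixes T U R :: "nat \<Rightarrow> 'a \<Rightarrow> real"
  assumes [measurable]: "\<And>n. T n \<in> borel_measurable M" "\<And>n. U n \<in> borel_measurable M"
      "\<And>n. R n \<in> borel_measurable M"
    and conv: "weak_conv_m (\<lambda>n. distr M borel (U n)) \<nu>"
    and cont: "\<And>x. isCont (cdf \<nu>) x"
    and R: "\<And>e. 0 < e \<Longrightarrow> (\<lambda>n. prob {\<omega>\<in>space M. e \<le> \<bar>R n \<omega> - 1\<bar>}) \<longlonglongrightarrow> 0"
    and T: "\<And>n \<omega>. \<omega> \<in> space M \<Longrightarrow> 0 < R n \<omega> \<Longrightarrow> T n \<omega> = U n \<omega> / R n \<omega>"
  shows "weak_conv_m (\<lambda>n. distr M borel (T n)) \<nu>"
  unfolding weak_conv_m_def weak_conv_def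
proof (intro allI impI)
  fix x
  have cdf_eq: "cdf (distr M borel V) y = prob {\<omega>\<in>space M. V \<omega> \<le> y}"
    if [measurable]: "V \<in> borel_measurable M" for V :: "'a \<Rightarrow> real" and y
    unfolding cdf_def by (simp add: measure_distr vimage_def Collect_conj_eq Int_commute)
  have U_lim: "(\<lambda>n. cdf (distr M borel (U n)) y) \<longlonglongrightarrow> cdf \<nu> y" for y
    using conv cont unfolding weak_conv_m_def weak_conv_def by blast
  show "(\<lambda>n. cdf (distr M borel (T n)) x) \<longlonglongrightarrow> cdf \<nu> x"
  proof (rule tendstoI)
    fix e :: real assume e: "0 < e"
    from cont[of x] e obtain d where d: "0 < d"
      "\<And>y. dist y x < d \<Longrightarrow> dist (cdf \<nu> y) (cdf \<nu> x) < e / 3"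
      unfolding continuous_at_eps_delta by (metis divide_pos_pos zero_less_numeral)
    \<comment> \<open>The bound \<open>1 / 2\<close> keeps \<open>R n\<close> positive; the other
      bound gives \<open>\<delta> * \<bar>x\<bar> < d\<close>, with \<open>1 + \<bar>x\<bar>\<close>
      in the denominator so that \<open>x = 0\<close> is covered.\<close>
    define \<delta> where "\<delta> = min (1 / 2) (d / (2 * (1 + \<bar>x\<bar>)))"
    have \<delta>: "0 < \<delta>" "\<delta> < 1" using d by (auto simp: \<delta>_def)
    have "\<delta> * \<bar>x\<bar> \<le> d / (2 * (1 + \<bar>x\<bar>)) * \<bar>x\<bar>"
      unfolding \<delta>_def by (intro mult_right_mono) auto
    also have "\<dots> < d"
      using d(1) by (simp add: field_simps) (simp add: add_nonneg_pos)
    finally have \<delta>x: "\<delta> * \<bar>x\<bar> < d" .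
    define p where "p n = prob {\<omega>\<in>space M. \<delta> \<le> \<bar>R n \<omega> - 1\<bar>}" for n
    let ?F = "\<lambda>V y. prob {\<omega>\<in>space M. V \<omega> \<le> y}"
    have sand: "x - \<delta> * \<bar>x\<bar> \<le> x * r \<and> x * r \<le> x + \<delta> * \<bar>x\<bar>" if "\<bar>r - 1\<bar> < \<delta>" for r
    proof -
      have "\<bar>x * r - x\<bar> = \<bar>x\<bar> * \<bar>r - 1\<bar>" by (simp add: abs_mult[symmetric] algebra_simps)
      also have "\<dots> \<le> \<bar>x\<bar> * \<delta>" using that by (intro mult_left_mono) auto
      finally show ?thesis by (auto simp: abs_le_iff mult.commute)
    qed
    have iff: "T n \<omega> \<le> x \<longleftrightarrow> U n \<omega> \<le> x * R n \<omega>" if "\<omega> \<in> space M" "\<bar>R n \<omega> - 1\<bar> < \<delta>" for n \<omega>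
    proof -
      have "0 < R n \<omega>" using that \<delta> by auto
      then show ?thesis using T[OF that(1)] by (simp add: pos_divide_le_eq)
    qed
    have up: "?F (T n) x \<le> ?F (U n) (x + \<delta> * \<bar>x\<bar>) + p n" for n
    proof -
      have "?F (T n) x \<le> prob ({\<omega>\<in>space M. U n \<omega> \<le> x + \<delta> * \<bar>x\<bar>} \<union> {\<omega>\<in>space M. \<delta> \<le> \<bar>R n \<omega> - 1\<bar>})"
        by (intro finite_measure_mono) (auto simp: not_le iff intro: order_trans[OF _ conjunct2[OF sand]])
      also have "\<dots> \<le> ?F (U n) (x + \<delta> * \<bar>x\<bar>) + p n"
        unfolding p_def by (intro measure_Un_le) auto
      finally show ?thesis .
    qed
    have lo: "?F (U n) (x - \<delta> * \<bar>x\<bar>) \<le> ?F (T n) x + p n" for n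
    proof -
      have "?F (U n) (x - \<delta> * \<bar>x\<bar>) \<le> prob ({\<omega>\<in>space M. T n \<omega> \<le> x} \<union> {\<omega>\<in>space M. \<delta> \<le> \<bar>R n \<omega> - 1\<bar>})"
        by (intro finite_measure_mono) (auto simp: not_le iff intro: order_trans[OF _ conjunct1[OF sand]])
      also have "\<dots> \<le> ?F (T n) x + p n"
        unfolding p_def by (intro measure_Un_le) auto
      finally show ?thesis .
    qed
    have close: "dist (cdf \<nu> (x + \<delta> * \<bar>x\<bar>)) (cdf \<nu> x) < e / 3" "dist (cdf \<nu> (x - \<delta> * \<bar>x\<bar>)) (cdf \<nu> x) < e / 3"
      using \<delta>x \<delta> by (intro d(2); simp add: dist_real_def)+
    have "\<forall>\<^sub>F n in sequentially. p n < e / 3"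
      using order_tendstoD(2)[OF R[OF \<delta>(1)], of "e / 3"] e by (simp add: p_def)
    moreover have "\<forall>\<^sub>F n in sequentially. dist (cdf (distr M borel (U n)) (x + \<delta> * \<bar>x\<bar>)) (cdf \<nu> (x + \<delta> * \<bar>x\<bar>)) < e / 3"
      "\<forall>\<^sub>F n in sequentially. dist (cdf (distr M borel (U n)) (x - \<delta> * \<bar>x\<bar>)) (cdf \<nu> (x - \<delta> * \<bar>x\<bar>)) < e / 3"
      using e by (intro tendstoD[OF U_lim]; simp)+
    ultimately show "\<forall>\<^sub>F n in sequentially. dist (cdf (distr M borel (T n)) x) (cdf \<nu> x) < e"
    proof eventually_elim
      case (elim n)
      then show ?case
        using up[of n] lo[of n] close
        unfolding cdf_eq[OF assms(1)] cdf_eq[OF assms(2)] dist_real_def by linarith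
    qed
  qed
qed

section \<open>The studentized statistic and its central limit theorem\<close>

lemma T_ac_measurable [measurable (raw)]:
  assumes "\<And>i. i \<in> {1..n} \<Longrightarrow> Z i \<in> borel_measurable M"
  shows "T_ac c Z n \<in> borel_measurable M"
proof -
  have [measurable]: "(\<lambda>\<omega>. \<Sum>i=1..n. Z i \<omega>) \<in> borel_measurable M"
    using assms by simp
  have [measurable]: "(\<lambda>\<omega>. \<Sum>i=1..n. (Z i \<omega> - (\<Sum>i=1..n. Z i \<omega>) / real n)\<^sup>2) \<in> borel_measurable M"
    by (rule borel_measurable_sum) (use assms in measurable)
  show ?thesis
    unfolding T_ac_def[abs_def] sample_var_def sample_mean_def by measurable
qed

text \<open>The two points may lie in different spaces. This serves to move the statistic between
  \<open>M\<close> and the product of the ranges of \<open>B\<close> and \<open>D\<close>.\<close>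

lemma T_ac_cong:
  assumes "\<And>i. i \<in> {1..n} \<Longrightarrow> Z i \<omega> = Z' i \<omega>'"
  shows "T_ac c Z n \<omega> = T_ac c Z' n \<omega>'"
proof -
  have m: "sample_mean Z n \<omega> = sample_mean Z' n \<omega>'"
    unfolding sample_mean_def by (rule arg_cong2[where f="(/)", OF sum.cong]) (simp_all add: assms)
  have "sample_var Z n \<omega> = sample_var Z' n \<omega>'"
    unfolding sample_var_def m by (rule arg_cong2[where f="(/)", OF sum.cong]) (simp_all add: assms)
  with m show ?thesis by (simp add: T_ac_def)
qed

text \<open>Expanding the square leaves only the averages of the variables and of their squares, and
  the weak law applies to both.\<close>

lemma sample_var_altdef:
  assumes "2 \<le> n"
  shows "sample_var Z n \<omega> =
    real n / (real n - 1) * ((\<Sum>i=1..n. (Z i \<omega>)\<^sup>2) / real n - (sample_mean Z n \<omega>)\<^sup>2)"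
proof -
  let ?m = "sample_mean Z n \<omega>"
  have m: "(\<Sum>i=1..n. Z i \<omega>) = real n * ?m"
    using assms by (simp add: sample_mean_def)
  have "(\<Sum>i=1..n. (Z i \<omega> - ?m)\<^sup>2) = (\<Sum>i=1..n. (Z i \<omega>)\<^sup>2) - 2 * ?m * (\<Sum>i=1..n. Z i \<omega>) + real n * ?m\<^sup>2"
    by (simp add: power2_diff sum.distrib sum_subtractf sum_distrib_left mult_ac)
  also have "\<dots> = (\<Sum>i=1..n. (Z i \<omega>)\<^sup>2) - real n * ?m\<^sup>2"
    unfolding m by (simp add: power2_eq_square algebra_simps)
  also have "\<dots> = real n * ((\<Sum>i=1..n. (Z i \<omega>)\<^sup>2) / real n - ?m\<^sup>2)"
    using assms by (simp add: right_diff_distrib)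
  finally show ?thesis
    by (simp add: sample_var_def)
qed

lemma isCont_cdf_std_normal: "isCont (cdf std_normal_distribution) x"
proof -
  interpret N: real_distribution std_normal_distribution
    by (rule real_dist_normal_dist)
  have "AE y in lborel. y \<noteq> x"
    by (rule AE_lborel_singleton)
  then have "emeasure std_normal_distribution {x} = 0"
    by (subst emeasure_density)
      (auto simp: nn_integral_0_iff_AE indicator_def elim!: eventually_mono)
  then show ?thesis
    unfolding N.isCont_cdf by (simp add: measure_def)
qed

text \<open>The statistic is the sum normalized by the true standard deviation, divided by the ratio
  \<open>R n\<close> of estimated to true standard deviation. The numerator is asymptotically normal
  and the ratio tends to 1 in probability.\<close>

theorem (in prob_space) central_limit_theorem_studentized:
  fixes W :: "nat \<Rightarrow> 'a \<Rightarrow> real"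
  assumes indep: "indep_vars (\<lambda>_. borel) W {1..}"
    and distrib: "\<And>i. 1 \<le> i \<Longrightarrow> distr M borel (W i) = \<nu>"
    and sq: "integrable \<nu> (\<lambda>x. x\<^sup>2)"
    and mean: "(\<integral>x. x \<partial>\<nu>) = 0"
    and var: "0 < (\<integral>x. x\<^sup>2 \<partial>\<nu>)"
  shows "weak_conv_m (\<lambda>n. distr M borel (T_ac c W n)) std_normal_distribution"
proof -
  have W[measurable]: "W i \<in> borel_measurable M" if "1 \<le> i" for i
    using indep that unfolding indep_vars_def2 by simp
  \<comment> \<open>Test data are numbered from 1, while the central limit theorem and the weak law
    sum over \<open>i<n\<close>.\<close>
  define X where "X i = W (Suc i)" for i
  have X[measurable]: "X i \<in> borel_measurable M" for i
    unfolding X_def by simp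
  have X_indep: "indep_vars (\<lambda>_. borel) X UNIV"
    unfolding X_def by (rule indep_vars_reindex[OF indep]) auto
  have X_distr: "distr M borel (X i) = \<nu>" for i
    unfolding X_def by (simp add: distrib)
  have X_sq: "integrable M (\<lambda>\<omega>. (X i \<omega>)\<^sup>2)" for i
    using sq unfolding X_distr[of i, symmetric] by (simp add: integrable_distr_eq)
  have X_int: "integrable M (X i)" for i
    by (rule square_integrable_imp_integrable[OF _ X_sq]) simp
  have X_mean: "expectation (X i) = 0" for i
    using mean unfolding X_distr[of i, symmetric] by (simp add: integral_distr)
  define s where "s = (\<integral>x. x\<^sup>2 \<partial>\<nu>)"
  have s: "0 < s" using var by (simp add: s_def)
  have X_var: "expectation (\<lambda>\<omega>. (X i \<omega>)\<^sup>2) = s" for i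
    unfolding s_def X_distr[of i, symmetric] by (simp add: integral_distr)
  have shift: "(\<Sum>i=1..n. f (W i \<omega>)) = (\<Sum>i<n. f (X i \<omega>))" for n \<omega> and f :: "real \<Rightarrow> real"
    unfolding X_def by (simp add: sum.atLeast1_atMost_eq)
  have mean_eq: "sample_mean W n \<omega> = (\<Sum>i<n. X i \<omega>) / real n" for n \<omega>
    using shift[of "\<lambda>x. x"] by (simp add: sample_mean_def)
  have var_meas[measurable]: "sample_var W n \<in> borel_measurable M" for n
    unfolding sample_var_def[abs_def] mean_eq shift[of "\<lambda>x. (x - _)\<^sup>2"] by measurable
  have T_meas: "T_ac c W n \<in> borel_measurable M" for n
    by (rule T_ac_measurable) simp
  have clt: "weak_conv_m (\<lambda>n. distr M borel (\<lambda>\<omega>. (\<Sum>i<n. X i \<omega>) / sqrt (n * (sqrt s)\<^sup>2))) std_normal_distribution"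
    by (rule central_limit_theorem_zero_mean[OF X_indep])
      (use s in \<open>simp_all add: X_mean X_sq X_var X_distr\<close>)
  have lln1: "(\<lambda>n. prob {\<omega>\<in>space M. e \<le> \<bar>sample_mean W n \<omega>\<bar>}) \<longlonglongrightarrow> 0" if "0 < e" for e
    using weak_law_of_large_numbers[OF X_indep X_distr X_int that]
    by (simp add: mean_eq X_mean)
  have lln2: "(\<lambda>n. prob {\<omega>\<in>space M. e \<le> \<bar>(\<Sum>i<n. (X i \<omega>)\<^sup>2) / real n - s\<bar>}) \<longlonglongrightarrow> 0" if "0 < e" for e
    unfolding X_var[of 0, symmetric]
  proof (rule weak_law_of_large_numbers[OF _ _ X_sq that])
    show "indep_vars (\<lambda>_. borel) (\<lambda>i \<omega>. (X i \<omega>)\<^sup>2) UNIV"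
      by (rule indep_vars_compose2[OF X_indep]) simp
    show "distr M borel (\<lambda>\<omega>. (X n \<omega>)\<^sup>2) = distr \<nu> borel (\<lambda>x. x\<^sup>2)" for n
      unfolding X_distr[of n, symmetric] by (subst distr_distr) (auto simp: comp_def)
  qed
  have var_lim: "(\<lambda>n. prob {\<omega>\<in>space M. e \<le> \<bar>sample_var W n \<omega> - s\<bar>}) \<longlonglongrightarrow> 0" if e: "0 < e" for e
  proof -
    \<comment> \<open>Writing \<open>n / (n - 1)\<close> as \<open>1 + 1 / (n - 1)\<close> splits
      the error into two terms, each allotted \<open>e / 2\<close>. The bound 1 turns a mean below
      \<eta> into a squared mean of at most \<eta>; the bound \<open>e / 4\<close> makes the second
      term less than \<open>2 * \<eta> \<le> e / 2\<close>.\<close>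
    define \<eta> where "\<eta> = min 1 (e / 4)"
    have \<eta>: "0 < \<eta>" "\<eta> \<le> 1" "\<eta> \<le> e / 4" using e by (auto simp: \<eta>_def)
    let ?a = "\<lambda>n. prob {\<omega>\<in>space M. \<eta> \<le> \<bar>(\<Sum>i<n. (X i \<omega>)\<^sup>2) / real n - s\<bar>}"
    let ?b = "\<lambda>n. prob {\<omega>\<in>space M. \<eta> \<le> \<bar>sample_mean W n \<omega>\<bar>}"
    have up: "(\<lambda>n. ?a n + ?b n) \<longlonglongrightarrow> 0"
      using tendsto_add[OF lln2[OF \<eta>(1)] lln1[OF \<eta>(1)]] by simp
    \<comment> \<open>Chosen for the term with denominator \<open>n - 1\<close>, whose numerator is
      at most \<open>s + 2\<close> in absolute value; hence the later threshold
      \<open>n0 + 1\<close> for \<open>n\<close>.\<close>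
    obtain n0 :: nat where n0: "(s + 2) * 2 / e < real n0"
      using reals_Archimedean2 by blast
    have close: "\<bar>sample_var W n \<omega> - s\<bar> < e"
      if n: "max 2 (n0 + 1) \<le> n" and a: "\<bar>(\<Sum>i<n. (X i \<omega>)\<^sup>2) / real n - s\<bar> < \<eta>"
        and b: "\<bar>sample_mean W n \<omega>\<bar> < \<eta>" for n \<omega>
    proof -
      define A where "A = (\<Sum>i<n. (X i \<omega>)\<^sup>2) / real n"
      define m where "m = sample_mean W n \<omega>"
      have n2: "2 \<le> n" "0 < real n - 1" using n by auto
      have m2: "m\<^sup>2 \<le> \<eta>"
      proof -
        have "m\<^sup>2 = \<bar>m\<bar> * \<bar>m\<bar>" by (simp add: power2_eq_square)
        also have "\<dots> \<le> \<eta> * 1" using b \<eta> by (intro mult_mono) (auto simp: m_def)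
        finally show ?thesis by simp
      qed
      have "sample_var W n \<omega> = real n / (real n - 1) * (A - m\<^sup>2)"
        using sample_var_altdef[OF n2(1), of W \<omega>] shift[of "\<lambda>x. x\<^sup>2" \<omega> n] by (simp add: A_def m_def)
      also have "\<dots> = (A - m\<^sup>2) / (real n - 1) + (A - m\<^sup>2)"
        using n2 by (simp add: field_simps)
      finally have eq: "sample_var W n \<omega> - s = (A - m\<^sup>2) / (real n - 1) + (A - s - m\<^sup>2)" by simp
      have A: "\<bar>A - s\<bar> < \<eta>" using a by (simp add: A_def)
      have "\<bar>A - m\<^sup>2\<bar> \<le> s + 2" using A m2 \<eta> s zero_le_power2[of m] by linarith
      then have "\<bar>(A - m\<^sup>2) / (real n - 1)\<bar> \<le> (s + 2) / (real n - 1)"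
        using n2 by (simp add: abs_divide divide_right_mono)
      also have "\<dots> \<le> e / 2"
      proof -
        have "(s + 2) * 2 / e \<le> real n - 1" using n0 n by simp
        then show ?thesis using n2 e by (simp add: field_simps)
      qed
      finally have "\<bar>(A - m\<^sup>2) / (real n - 1)\<bar> \<le> e / 2" .
      moreover have "\<bar>A - s - m\<^sup>2\<bar> < 2 * \<eta>" using A m2 zero_le_power2[of m] by linarith
      ultimately show ?thesis unfolding eq using \<eta>(3) by linarith
    qed
    show ?thesis
    proof (rule tendsto_sandwich[OF _ _ tendsto_const up])
      show "\<forall>\<^sub>F n in sequentially. prob {\<omega>\<in>space M. e \<le> \<bar>sample_var W n \<omega> - s\<bar>} \<le> ?a n + ?b n"
        using eventually_ge_at_top[of "max 2 (n0 + 1)"]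
      proof eventually_elim
        case (elim n)
        have [measurable]: "sample_mean W n \<in> borel_measurable M"
          unfolding mean_eq[abs_def] by measurable
        have "prob {\<omega>\<in>space M. e \<le> \<bar>sample_var W n \<omega> - s\<bar>}
          \<le> prob ({\<omega>\<in>space M. \<eta> \<le> \<bar>(\<Sum>i<n. (X i \<omega>)\<^sup>2) / real n - s\<bar>} \<union>
                  {\<omega>\<in>space M. \<eta> \<le> \<bar>sample_mean W n \<omega>\<bar>})"
          by (intro finite_measure_mono subsetI) (use close[OF elim] in \<open>force simp: not_le\<close>)+
        also have "\<dots> \<le> ?a n + ?b n"
          by (intro measure_Un_le) auto
        finally show ?case .
      qed
    qed simp
  qed
  define R where "R n \<omega> = sqrt (sample_var W n \<omega>) / sqrt s" for n \<omega>
  show ?thesis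
  proof (rule slutsky_divide[OF T_meas _ _ clt isCont_cdf_std_normal, where R=R])
    show "R n \<in> borel_measurable M" for n
      unfolding R_def[abs_def] by measurable
    fix n \<omega> assume R: "0 < R n \<omega>"
    then have v: "0 < sample_var W n \<omega>" using s by (simp add: R_def zero_less_divide_iff)
    \<comment> \<open>For \<open>n = 0\<close> the sample variance is an empty sum over -1, hence 0.
      A positive sample variance also excludes the branch of \<open>T_ac\<close> with value
      \<open>c\<close>.\<close>
    then have "0 < n" by (cases n) (auto simp: sample_var_def)
    then have "T_ac c W n \<omega> = (\<Sum>i<n. X i \<omega>) / (sqrt n * sqrt (sample_var W n \<omega>))"
      using v by (simp add: T_ac_def mean_eq real_sqrt_divide field_simps)
    then show "T_ac c W n \<omega> = (\<Sum>i<n. X i \<omega>) / sqrt (n * (sqrt s)\<^sup>2) / R n \<omega>"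
      using s by (simp add: R_def real_sqrt_mult)
  next
    fix e :: real assume e: "0 < e"
    have "0 < e * s" using e s by simp
    from var_lim[OF this]
    show "(\<lambda>n. prob {\<omega>\<in>space M. e \<le> \<bar>R n \<omega> - 1\<bar>}) \<longlonglongrightarrow> 0"
    proof (rule tendsto_sandwich[OF _ _ tendsto_const, rotated 2])
      \<comment> \<open>No continuity of the root is needed: since \<open>R n + 1\<close> is at
        least 1, the distance of \<open>R n\<close> from 1 is at most that of its square, which is
        the sample variance over \<open>s\<close>.\<close>
      have "e * s \<le> \<bar>sample_var W n \<omega> - s\<bar>" if "e \<le> \<bar>R n \<omega> - 1\<bar>" for n \<omega>
      proof -
        have nn: "0 \<le> sample_var W n \<omega>"
          by (cases "n = 0") (auto simp: sample_var_def intro!: divide_nonneg_nonneg sum_nonneg)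
        then have R0: "0 \<le> R n \<omega>" using s by (simp add: R_def)
        have "e \<le> \<bar>R n \<omega> - 1\<bar> * 1" using that by simp
        also have "\<dots> \<le> \<bar>R n \<omega> - 1\<bar> * (R n \<omega> + 1)" using R0 by (intro mult_left_mono) auto
        also have "\<dots> = \<bar>(R n \<omega>)\<^sup>2 - 1\<bar>"
          using R0 abs_mult[of "R n \<omega> - 1" "R n \<omega> + 1"]
          by (simp add: power2_eq_square algebra_simps)
        also have "(R n \<omega>)\<^sup>2 = sample_var W n \<omega> / s"
          using nn s by (simp add: R_def power_divide)
        finally show ?thesis
          using s by (simp add: abs_if field_simps split: if_splits)
      qed
      then show "\<forall>\<^sub>F n in sequentially. prob {\<omega>\<in>space M. e \<le> \<bar>R n \<omega> - 1\<bar>}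
          \<le> prob {\<omega>\<in>space M. e * s \<le> \<bar>sample_var W n \<omega> - s\<bar>}"
        by (intro always_eventually allI finite_measure_mono) auto
    qed simp
  qed (use X in measurable)
qed

section \<open>Conditioning on an independent variable and conditional distributions\<close>

context prob_space begin

lemma subalgebra_sigma_gen:
  assumes "X \<in> measurable M N"
  shows "subalgebra M (sigma_gen M N X)"
  unfolding subalgebra_def sigma_gen_def
  by (auto simp: sets_vimage_algebra2[OF measurable_space[OF assms, THEN funcsetI]] intro: measurable_sets[OF assms])

lemma finite_measure_subalgebra_sigma_gen:
  "X \<in> measurable M N \<Longrightarrow> finite_measure_subalgebra M (sigma_gen M N X)"
  by (simp add: finite_measure_axioms finite_measure_subalgebra_axioms_def
      finite_measure_subalgebra_def subalgebra_sigma_gen)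

lemma measurable_sigma_gen:
  assumes "X \<in> measurable M N"
  shows "X \<in> measurable (sigma_gen M N X) N"
  unfolding sigma_gen_def using measurable_space[OF assms] by (intro measurable_vimage_algebra1) auto

text \<open>Independence is the product formula on rectangles, and these determine a product of
  sigma-finite measures.\<close>

lemma indep_rv_distr_pair:
  assumes "indep_rv M K B L D"
  shows "distr M (K \<Otimes>\<^sub>M L) (\<lambda>\<omega>. (B \<omega>, D \<omega>)) = distr M K B \<Otimes>\<^sub>M distr M L D"
proof (rule pair_measure_eqI[symmetric])
  have [measurable]: "B \<in> measurable M K" "D \<in> measurable M L"
    and ind: "indep_set (sets (sigma_gen M K B)) (sets (sigma_gen M L D))"
    using assms by (auto simp: indep_rv_def)
  show "sigma_finite_measure (distr M K B)" "sigma_finite_measure (distr M L D)"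
    by (intro prob_space_imp_sigma_finite prob_space_distr; measurable)+
  show "sets (distr M K B \<Otimes>\<^sub>M distr M L D) = sets (distr M (K \<Otimes>\<^sub>M L) (\<lambda>\<omega>. (B \<omega>, D \<omega>)))"
    by (simp cong: sets_pair_measure_cong)
  fix A A' assume "A \<in> sets (distr M K B)" "A' \<in> sets (distr M L D)"
  then have [measurable]: "A \<in> sets K" "A' \<in> sets L" by auto
  have "prob ((B -` A \<inter> space M) \<inter> (D -` A' \<inter> space M)) = prob (B -` A \<inter> space M) * prob (D -` A' \<inter> space M)"
    by (rule indep_setD[OF ind]) (simp_all add: sigma_gen_def in_vimage_algebra)
  moreover have "(\<lambda>\<omega>. (B \<omega>, D \<omega>)) -` (A \<times> A') \<inter> space M = (B -` A \<inter> space M) \<inter> (D -` A' \<inter> space M)"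
    by auto
  ultimately show "emeasure (distr M K B) A * emeasure (distr M L D) A' =
      emeasure (distr M (K \<Otimes>\<^sub>M L) (\<lambda>\<omega>. (B \<omega>, D \<omega>))) (A \<times> A')"
    by (simp add: emeasure_distr emeasure_eq_measure ennreal_mult')
qed

lemma measurable_prob_section:
  assumes [measurable]: "D \<in> measurable M L" and S: "S \<in> sets (K \<Otimes>\<^sub>M L)"
  shows "(\<lambda>b. measure (distr M L D) (Pair b -` S)) \<in> borel_measurable K"
proof -
  interpret L: prob_space "distr M L D" by (rule prob_space_distr) simp
  have "S \<in> sets (K \<Otimes>\<^sub>M distr M L D)" using S by (simp cong: sets_pair_measure_cong)
  from L.measurable_emeasure_Pair[OF this] show ?thesis
    unfolding measure_def by (rule borel_measurable_enn2real)
qed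

text \<open>Fubini for the product law of \<open>(B, D)\<close>: freeze \<open>B\<close>, take the
  probability over \<open>D\<close>, then average over \<open>B\<close>.\<close>

lemma prob_indep_rv:
  assumes ind: "indep_rv M K B L D" and S: "S \<in> sets (K \<Otimes>\<^sub>M L)"
  shows "prob {\<omega>\<in>space M. (B \<omega>, D \<omega>) \<in> S} = (\<integral>\<omega>. measure (distr M L D) (Pair (B \<omega>) -` S) \<partial>M)"
proof -
  have [measurable]: "B \<in> measurable M K" "D \<in> measurable M L"
    using ind by (auto simp: indep_rv_def)
  interpret L: prob_space "distr M L D" by (rule prob_space_distr) simp
  note [measurable] = S measurable_prob_section[OF \<open>D \<in> measurable M L\<close> S]
  have S': "S \<in> sets (distr M K B \<Otimes>\<^sub>M distr M L D)"
    using S by (simp cong: sets_pair_measure_cong)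
  have "emeasure M {\<omega>\<in>space M. (B \<omega>, D \<omega>) \<in> S} = emeasure (distr M (K \<Otimes>\<^sub>M L) (\<lambda>\<omega>. (B \<omega>, D \<omega>))) S"
    by (simp add: emeasure_distr vimage_def Int_def conj_commute)
  also have "\<dots> = (\<integral>\<^sup>+b. emeasure (distr M L D) (Pair b -` S) \<partial>distr M K B)"
    unfolding indep_rv_distr_pair[OF ind] by (rule L.emeasure_pair_measure_alt[OF S'])
  also have "\<dots> = (\<integral>\<^sup>+\<omega>. ennreal (measure (distr M L D) (Pair (B \<omega>) -` S)) \<partial>M)"
    by (simp add: L.emeasure_eq_measure nn_integral_distr)
  finally show ?thesis
    by (subst integral_eq_nn_integral) (auto simp: measure_def[of M])
qed

text \<open>The freezing principle. An event of the sigma-algebra is the preimage under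
  \<open>B\<close> of some \<open>C\<close>; integrating over it amounts to cutting \<open>S\<close>
  down to \<open>C \<times> space L\<close>, so the characterizing integrals agree by
  \<open>prob_indep_rv\<close> for the smaller set.\<close>

lemma cond_prob_indep_rv:
  assumes ind: "indep_rv M K B L D" and S: "S \<in> sets (K \<Otimes>\<^sub>M L)"
  shows "AE \<omega> in M. cond_prob M (sigma_gen M K B) {\<omega>\<in>space M. (B \<omega>, D \<omega>) \<in> S} \<omega> =
    measure (distr M L D) (Pair (B \<omega>) -` S)"
  unfolding cond_prob_def
proof (rule sigma_finite_subalgebra.real_cond_exp_charact)
  have [measurable]: "B \<in> measurable M K" "D \<in> measurable M L"
    using ind by (auto simp: indep_rv_def)
  interpret L: prob_space "distr M L D" by (rule prob_space_distr) simp
  interpret F: finite_measure_subalgebra M "sigma_gen M K B"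
    by (rule finite_measure_subalgebra_sigma_gen) simp
  show "sigma_finite_subalgebra M (sigma_gen M K B)" ..
  note [measurable] = S measurable_prob_section[OF \<open>D \<in> measurable M L\<close> S]
  show "integrable M (indicat_real {\<omega>\<in>space M. (B \<omega>, D \<omega>) \<in> S})"
    by (intro integrable_real_indicator) (auto simp: less_top[symmetric])
  show "integrable M (\<lambda>\<omega>. measure (distr M L D) (Pair (B \<omega>) -` S))"
    by (rule integrable_const_bound[of _ 1]) auto
  show "(\<lambda>\<omega>. measure (distr M L D) (Pair (B \<omega>) -` S)) \<in> borel_measurable (sigma_gen M K B)"
    by (rule measurable_compose[OF measurable_sigma_gen]) auto
  fix A assume "A \<in> sets (sigma_gen M K B)"
  then obtain C where C[measurable]: "C \<in> sets K" and A: "A = B -` C \<inter> space M"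
    unfolding sigma_gen_def
    by (auto simp: sets_vimage_algebra2[OF measurable_space[OF \<open>B \<in> measurable M K\<close>, THEN funcsetI]])
  define S' where "S' = S \<inter> (C \<times> space L)"
  have S': "S' \<in> sets (K \<Otimes>\<^sub>M L)" unfolding S'_def by measurable
  have sub: "S \<subseteq> space K \<times> space L"
    using sets.sets_into_space[OF S] by (simp add: space_pair_measure)
  have "(\<integral>\<omega>\<in>A. indicat_real {\<omega>\<in>space M. (B \<omega>, D \<omega>) \<in> S} \<omega> \<partial>M)
      = (\<integral>\<omega>. indicator {\<omega>\<in>space M. (B \<omega>, D \<omega>) \<in> S'} \<omega> \<partial>M)"
    unfolding set_lebesgue_integral_def A S'_def using sub
    by (intro Bochner_Integration.integral_cong) (auto simp: indicator_def)
  also have "\<dots> = prob {\<omega>\<in>space M. (B \<omega>, D \<omega>) \<in> S'}"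
    by (simp add: Int_absorb2)
  also have "\<dots> = (\<integral>\<omega>. measure (distr M L D) (Pair (B \<omega>) -` S') \<partial>M)"
    by (rule prob_indep_rv[OF ind S'])
  also have "\<dots> = (\<integral>\<omega>\<in>A. measure (distr M L D) (Pair (B \<omega>) -` S) \<partial>M)"
    unfolding set_lebesgue_integral_def A S'_def using sub
    by (intro Bochner_Integration.integral_cong)
      (auto simp: indicator_def vimage_def intro!: arg_cong[where f="measure _"])
  finally show "(\<integral>\<omega>\<in>A. indicat_real {\<omega>\<in>space M. (B \<omega>, D \<omega>) \<in> S} \<omega> \<partial>M)
      = (\<integral>\<omega>\<in>A. measure (distr M L D) (Pair (B \<omega>) -` S) \<partial>M)" .
qed

end

text \<open>A distribution function is determined by its values at the rationals, so countably many null
  sets suffice.\<close>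

lemma real_distribution_eqI_rat:
  assumes "real_distribution \<mu>" "real_distribution \<nu>"
    and eq: "\<And>q. q \<in> \<rat> \<Longrightarrow> measure \<mu> {..q} = measure \<nu> {..q}"
  shows "\<mu> = \<nu>"
proof (rule cdf_unique[OF assms(1,2)], rule ext, rule ccontr)
  interpret M: real_distribution \<mu> by fact
  interpret N: real_distribution \<nu> by fact
  fix x assume ne: "cdf \<mu> x \<noteq> cdf \<nu> x"
  \<comment> \<open>By right-continuity a difference at \<open>x\<close> persists on an interval to
    the right of \<open>x\<close>, and that interval contains a rational.\<close>
  have "((\<lambda>y. cdf \<mu> y - cdf \<nu> y) \<longlongrightarrow> cdf \<mu> x - cdf \<nu> x) (at_right x)"
    using M.cdf_is_right_cont[of x] N.cdf_is_right_cont[of x]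
    unfolding continuous_within by (intro tendsto_diff)
  then have "\<forall>\<^sub>F y in at_right x. cdf \<mu> y - cdf \<nu> y \<noteq> 0"
    by (rule tendsto_imp_eventually_ne) (use ne in simp)
  then obtain b where "x < b" "\<And>y. x < y \<Longrightarrow> y < b \<Longrightarrow> cdf \<mu> y - cdf \<nu> y \<noteq> 0"
    unfolding eventually_at_right_field by auto
  moreover obtain q where "q \<in> \<rat>" "x < q" "q < b"
    using Rats_dense_in_real[OF \<open>x < b\<close>] by auto
  ultimately show False using eq[of q] by (simp add: cdf_def)
qed

text \<open>Makes the arbitrary choice in \<open>cond_distr\<close> harmless: an explicit kernel may
  replace it almost surely. Each half-line contributes its own null set, so only rational end points
  are compared.\<close>

lemma AE_cond_distr_eq:
  assumes sub: "subalgebra M F" and K: "is_cond_distr M F Z K"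
  shows "AE \<omega> in M. cond_distr M F Z \<omega> = K \<omega>"
proof -
  have K': "is_cond_distr M F Z (cond_distr M F Z)"
    unfolding cond_distr_def by (rule someI[of "is_cond_distr M F Z", OF K])
  have dist: "real_distribution (L \<omega>)" if "is_cond_distr M F Z L" "\<omega> \<in> space M" for L \<omega>
  proof -
    have "L \<omega> \<in> space (prob_algebra borel)"
      using that sub by (auto simp: is_cond_distr_def subalgebra_def dest: measurable_space)
    then show ?thesis
      by (simp add: space_prob_algebra real_distribution_def real_distribution_axioms_def)
  qed
  have "AE \<omega> in M. \<forall>q\<in>\<rat>. measure (cond_distr M F Z \<omega>) {..q} = measure (K \<omega>) {..q}"
  proof (rule AE_ball_countable[THEN iffD2, OF countable_rat], intro ballI)
    fix q :: real
    have "AE \<omega> in M. measure (L \<omega>) {..q} = cond_prob M F {\<omega>\<in>space M. Z \<omega> \<in> {..q}} \<omega>"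
      if "is_cond_distr M F Z L" for L
      using that unfolding is_cond_distr_def by (elim conjE) (erule bspec, simp)
    from this[OF K] this[OF K']
    show "AE \<omega> in M. measure (cond_distr M F Z \<omega>) {..q} = measure (K \<omega>) {..q}"
      by eventually_elim simp
  qed
  then show ?thesis
    using AE_space
    by eventually_elim (rule real_distribution_eqI_rat, use dist[OF K] dist[OF K'] in auto)
qed

text \<open>The residual has conditional expectation 0 given \<open>\<mu> (X \<omega>)\<close>, and
  a factor measurable for that sigma-algebra can be pulled out. Integrability is asked of the
  product alone, which is what a finite conditional variance supplies.\<close>

lemma (in prob_space) auto_calibrated_integral_eq_0:
  assumes X[measurable]: "X \<in> measurable M N" and Y: "integrable M Y"
    and ac: "auto_calibrated M N \<mu> Y X"
    and h: "h \<in> borel_measurable (restrict_space borel (\<mu> ` space N))"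
    and int: "integrable M (\<lambda>\<omega>. (Y \<omega> - \<mu> (X \<omega>)) * h (\<mu> (X \<omega>)))"
  shows "(\<integral>\<omega>. (Y \<omega> - \<mu> (X \<omega>)) * h (\<mu> (X \<omega>)) \<partial>M) = 0"
proof -
  have \<mu>[measurable]: "\<mu> \<in> borel_measurable N" using ac by (simp add: auto_calibrated_def)
  let ?F = "sigma_gen M borel (\<lambda>\<omega>. \<mu> (X \<omega>))"
  interpret F: finite_measure_subalgebra M ?F
    by (rule finite_measure_subalgebra_sigma_gen) simp
  have \<mu>X: "(\<lambda>\<omega>. \<mu> (X \<omega>)) \<in> borel_measurable ?F"
    by (rule measurable_sigma_gen) simp
  \<comment> \<open>As \<open>h\<close> is measurable only for the trace on the image of \<mu>, the
    composition must pass through that restricted space.\<close>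
  have "(\<lambda>\<omega>. \<mu> (X \<omega>)) \<in> measurable ?F (restrict_space borel (\<mu> ` space N))"
    by (rule measurable_restrict_space2[OF _ \<mu>X])
      (auto simp: sigma_gen_def dest: measurable_space[OF X])
  from measurable_compose[OF this h]
  have hF: "(\<lambda>\<omega>. h (\<mu> (X \<omega>))) \<in> borel_measurable ?F" .
  have Y_m[measurable]: "Y \<in> borel_measurable M" using Y by simp
  have ae: "AE \<omega> in M. \<mu> (X \<omega>) = real_cond_exp M ?F Y \<omega>"
    using ac by (simp add: auto_calibrated_def)
  \<comment> \<open>Integrability of the prediction is inherited from \<open>Y\<close>: by
    auto-calibration it is a conditional expectation of \<open>Y\<close>.\<close>
  have \<mu>_int: "integrable M (\<lambda>\<omega>. \<mu> (X \<omega>))"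
    using F.real_cond_exp_int(1)[OF Y] ae
    by (subst integrable_cong_AE[where g="real_cond_exp M ?F Y"]) auto
  have "AE \<omega> in M. real_cond_exp M ?F (\<lambda>\<omega>. Y \<omega> - \<mu> (X \<omega>)) \<omega> = 0"
    using F.real_cond_exp_diff[OF Y \<mu>_int] F.real_cond_exp_F_meas[OF \<mu>_int \<mu>X] ae
    by (auto elim: AE_mp)
  then have "(\<integral>\<omega>. h (\<mu> (X \<omega>)) * real_cond_exp M ?F (\<lambda>\<omega>. Y \<omega> - \<mu> (X \<omega>)) \<omega> \<partial>M) = 0"
    by (intro integral_eq_zero_AE) (auto elim: eventually_mono)
  then show ?thesis
    using F.real_cond_exp_intg(2)[OF _ hF, of "\<lambda>\<omega>. Y \<omega> - \<mu> (X \<omega>)"] int by (simp add: mult.commute)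
qed

text \<open>The centre \<open>m\<close> is arbitrary because \<open>cond_variance\<close> subtracts
  a Bochner integral, which is the default 0 until integrability is known.\<close>

lemma (in prob_space) square_integrable_of_finite_centered_moment:
  fixes f :: "'a \<Rightarrow> real"
  assumes [measurable]: "f \<in> borel_measurable M"
    and fin: "(\<integral>\<^sup>+\<omega>. ennreal ((f \<omega> - m)\<^sup>2) \<partial>M) < \<infinity>"
  shows "integrable M (\<lambda>\<omega>. (f \<omega>)\<^sup>2)"
proof -
  have "integrable M (\<lambda>\<omega>. (f \<omega> - m)\<^sup>2)"
    by (rule integrableI_bounded) (use fin in auto)
  then have "integrable M (\<lambda>\<omega>. 2 * (f \<omega> - m)\<^sup>2 + 2 * m\<^sup>2)" by simp
  then show ?thesis
  proof (rule Bochner_Integration.integrable_bound)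
    have "(f \<omega>)\<^sup>2 \<le> 2 * (f \<omega> - m)\<^sup>2 + 2 * m\<^sup>2" for \<omega>
      \<comment> \<open>The right side minus the left is exactly
        \<open>(f \<omega> - 2 * m)\<^sup>2\<close>.\<close>
      using zero_le_power2[of "f \<omega> - 2 * m"] by (simp add: power2_eq_square algebra_simps)
    then show "AE \<omega> in M. norm ((f \<omega>)\<^sup>2) \<le> norm (2 * (f \<omega> - m)\<^sup>2 + 2 * m\<^sup>2)"
      by (simp add: abs_of_nonneg)
  qed simp
qed

theorem proposition3p4:
  fixes M :: "'a measure" and N :: "'x measure"
    and Y :: "'a \<Rightarrow> real" and X :: "'a \<Rightarrow> 'x"
    and Ys :: "nat \<Rightarrow> 'a \<Rightarrow> real" and Xs :: "nat \<Rightarrow> 'a \<Rightarrow> 'x"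
    and J :: "'j set" and YB :: "'j \<Rightarrow> 'a \<Rightarrow> real" and XB :: "'j \<Rightarrow> 'a \<Rightarrow> 'x"
    and \<mu> :: "'x \<Rightarrow> real" and h :: "('j \<Rightarrow> real \<times> 'x) \<Rightarrow> real \<Rightarrow> real"
    and c :: real
  defines "P \<equiv> borel \<Otimes>\<^sub>M N"
    and "D \<equiv> (\<lambda>\<omega>. \<lambda>i\<in>{1..}. (Ys i \<omega>, Xs i \<omega>))"
    and "B \<equiv> (\<lambda>\<omega>. \<lambda>j\<in>J. (YB j \<omega>, XB j \<omega>))"
    and "Z \<equiv> (\<lambda>i \<omega>. (Ys i \<omega> - \<mu> (Xs i \<omega>)) *
                 h (\<lambda>j\<in>J. (YB j \<omega>, XB j \<omega>)) (\<mu> (Xs i \<omega>)))"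
  assumes "prob_space M"
    and "Y \<in> borel_measurable M" and "integrable M (\<lambda>\<omega>. (Y \<omega>)\<^sup>2)"
    and "X \<in> measurable M N"
    and "prob_space.indep_vars M (\<lambda>_. P) (\<lambda>i \<omega>. (Ys i \<omega>, Xs i \<omega>)) {1..}"
    and "\<And>i. i \<ge> 1 \<Longrightarrow>
           distr M P (\<lambda>\<omega>. (Ys i \<omega>, Xs i \<omega>)) = distr M P (\<lambda>\<omega>. (Y \<omega>, X \<omega>))"
    and "finite J"
    and "prob_space.indep_vars M (\<lambda>_. P) (\<lambda>j \<omega>. (YB j \<omega>, XB j \<omega>)) J"
    and "\<And>j k. j \<in> J \<Longrightarrow> k \<in> J \<Longrightarrow>
           distr M P (\<lambda>\<omega>. (YB j \<omega>, XB j \<omega>)) = distr M P (\<lambda>\<omega>. (YB k \<omega>, XB k \<omega>))"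
    and "indep_rv M (PiM J (\<lambda>_. P)) B (PiM {1..} (\<lambda>_. P)) D"
    and "indep_rv M P (\<lambda>\<omega>. (Y \<omega>, X \<omega>))
           (PiM {1..} (\<lambda>_. P) \<Otimes>\<^sub>M PiM J (\<lambda>_. P)) (\<lambda>\<omega>. (D \<omega>, B \<omega>))"
    and "\<mu> \<in> borel_measurable N"
    and "(\<lambda>(b, m). h b m) \<in> borel_measurable
           (PiM J (\<lambda>_. P) \<Otimes>\<^sub>M restrict_space borel (\<mu> ` space N))"
  shows "(\<forall>n\<ge>2. cond_iid M (sigma_gen M (PiM J (\<lambda>_. P)) B) {1..n} Z) \<and>
         ((\<forall>i\<ge>1. AE \<omega> in M.
             0 < cond_variance M (sigma_gen M (PiM J (\<lambda>_. P)) B) (Z i) \<omega> \<and>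
             cond_variance M (sigma_gen M (PiM J (\<lambda>_. P)) B) (Z i) \<omega> < \<infinity>) \<longrightarrow>
          auto_calibrated M N \<mu> Y X \<longrightarrow>
          weak_conv_m (\<lambda>n. distr M borel (T_ac c Z n)) std_normal_distribution)"
proof -
  interpret prob_space M by fact

  \<comment> \<open>Frozen variables and their measurability\<close>
  define K where "K = PiM J (\<lambda>_. P)"
  define L where "L = PiM {1::nat..} (\<lambda>_. P)"
  define Q where "Q = distr M P (\<lambda>\<omega>. (Y \<omega>, X \<omega>))"
  \<comment> \<open>With \<open>B\<close> frozen at \<open>b\<close>, the variable
    \<open>Z i\<close> becomes \<open>g b\<close> of the \<open>i\<close>-th test pair, and
    \<open>Q\<close> is the common law of these pairs.\<close>
  define g where "g b p = (fst p - \<mu> (snd p)) * h b (\<mu> (snd p))" for b and p :: "real \<times> 'x"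
  let ?F = "sigma_gen M K B"
  note Y = \<open>Y \<in> borel_measurable M\<close> \<open>integrable M (\<lambda>\<omega>. (Y \<omega>)\<^sup>2)\<close>
  note ident = \<open>\<And>i. i \<ge> 1 \<Longrightarrow> distr M P (\<lambda>\<omega>. (Ys i \<omega>, Xs i \<omega>)) = distr M P (\<lambda>\<omega>. (Y \<omega>, X \<omega>))\<close>
  note indep = \<open>indep_vars (\<lambda>_. P) (\<lambda>i \<omega>. (Ys i \<omega>, Xs i \<omega>)) {1..}\<close>
  have YX[measurable]: "(\<lambda>\<omega>. (Y \<omega>, X \<omega>)) \<in> measurable M P"
    using Y \<open>X \<in> measurable M N\<close> unfolding P_def by measurable
  have pairs[measurable]: "(\<lambda>\<omega>. (Ys i \<omega>, Xs i \<omega>)) \<in> measurable M P" if "1 \<le> i" for i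
    using indep that unfolding indep_vars_def2 by auto
  have distr_pair: "distr M P (\<lambda>\<omega>. (Ys i \<omega>, Xs i \<omega>)) = Q" if "1 \<le> i" for i
    using ident[OF that] by (simp add: Q_def)
  have ind: "indep_rv M K B L D" unfolding K_def L_def by fact
  then have B[measurable]: "B \<in> measurable M K" and D[measurable]: "D \<in> measurable M L"
    by (auto simp: indep_rv_def)
  interpret Q: prob_space Q unfolding Q_def by (rule prob_space_distr) simp
  have sets_Q[measurable_cong]: "sets Q = sets P" by (simp add: Q_def)
  interpret F: finite_measure_subalgebra M ?F
    by (rule finite_measure_subalgebra_sigma_gen) simp

  have \<mu>P: "(\<lambda>p. \<mu> (snd p)) \<in> measurable P (restrict_space borel (\<mu> ` space N))"
    using \<open>\<mu> \<in> borel_measurable N\<close>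
    by (intro measurable_restrict_space2) (auto simp: P_def space_pair_measure)
  have "(\<lambda>(b, p). h b (\<mu> (snd p))) \<in> borel_measurable (K \<Otimes>\<^sub>M P)"
    using measurable_compose[OF _ \<open>(\<lambda>(b, m). h b m) \<in> borel_measurable _\<close>,
        of "\<lambda>(b, p). (b, \<mu> (snd p))" "K \<Otimes>\<^sub>M P"] \<mu>P
    by (simp add: K_def split_beta)
  then have g_pair[measurable]: "(\<lambda>(b, p). g b p) \<in> borel_measurable (K \<Otimes>\<^sub>M P)"
    using \<open>\<mu> \<in> borel_measurable N\<close> unfolding g_def P_def split_beta by measurable
  have g[measurable]: "g b \<in> borel_measurable P" if "b \<in> space K" for b
    using measurable_Pair2[OF g_pair that] by simp
  have B_space: "B \<omega> \<in> space K" if "\<omega> \<in> space M" for \<omega>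
    using measurable_space[OF B that] .
  have Z_eq: "Z i \<omega> = g (B \<omega>) (Ys i \<omega>, Xs i \<omega>)" for i \<omega>
    by (simp add: Z_def g_def B_def)
  have D_nth: "D \<omega> i = (Ys i \<omega>, Xs i \<omega>)" if "1 \<le> i" for \<omega> i
    using that by (simp add: D_def)
  have coord[measurable]: "(\<lambda>d. d i) \<in> measurable L P" if "1 \<le> i" for i
    unfolding L_def using that by (intro measurable_component_singleton) simp
  have Z_meas[measurable]: "Z i \<in> borel_measurable M" if "1 \<le> i" for i
    unfolding Z_eq[abs_def]
    using measurable_compose[OF measurable_Pair[OF B pairs[OF that]] g_pair] by simp

  have distr_g: "distr M borel (\<lambda>\<omega>. g b (Ys i \<omega>, Xs i \<omega>)) = distr Q borel (g b)"
    if "1 \<le> i" "b \<in> space K" for b i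
    unfolding distr_pair[OF that(1), symmetric] using g[OF that(2)] pairs[OF that(1)]
    by (subst distr_distr) (auto simp: comp_def)

  \<comment> \<open>Conditional independence and identical distribution given
    \<open>B\<close>\<close>
  have cond_prob_Z: "AE \<omega> in M. cond_prob M ?F {\<omega>\<in>space M. \<forall>i\<in>I. Z i \<omega> \<in> A i} \<omega> =
      (\<Prod>i\<in>I. measure (distr Q borel (g (B \<omega>))) (A i))"
    if I: "I \<subseteq> {1..}" "finite I" and A: "\<And>i. i \<in> I \<Longrightarrow> A i \<in> sets borel" for I A
  proof -
    \<comment> \<open>The joint event as a set of values of \<open>(B, D)\<close>; its section at
      \<open>b\<close> concerns independent functions of the test pairs only.\<close>
    define S where "S = {x \<in> space (K \<Otimes>\<^sub>M L). \<forall>i\<in>I. g (fst x) (snd x i) \<in> A i}"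
    have S: "S \<in> sets (K \<Otimes>\<^sub>M L)"
      unfolding S_def
    proof (rule sets.sets_Collect_finite_All[OF _ I(2)])
      fix i assume i: "i \<in> I"
      then have "1 \<le> i" using I by auto
      from coord[OF this] have "(\<lambda>x. (fst x, snd x i)) \<in> measurable (K \<Otimes>\<^sub>M L) (K \<Otimes>\<^sub>M P)"
        by measurable
      from measurable_compose[OF this g_pair] have "(\<lambda>x. g (fst x) (snd x i)) \<in> borel_measurable (K \<Otimes>\<^sub>M L)"
        by simp
      from measurable_sets[OF this A[OF i]]
      show "{x \<in> space (K \<Otimes>\<^sub>M L). g (fst x) (snd x i) \<in> A i} \<in> sets (K \<Otimes>\<^sub>M L)"
        by (simp add: vimage_def Int_def conj_commute)
    qed
    have ev: "{\<omega>\<in>space M. (B \<omega>, D \<omega>) \<in> S} = {\<omega>\<in>space M. \<forall>i\<in>I. Z i \<omega> \<in> A i}"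
      using I measurable_space[OF B] measurable_space[OF D]
      by (auto simp: S_def Z_eq D_nth space_pair_measure subset_iff)
    have section_prob: "measure (distr M L D) (Pair b -` S) = (\<Prod>i\<in>I. measure (distr Q borel (g b)) (A i))"
      if b: "b \<in> space K" for b
    proof -
      have W: "indep_vars (\<lambda>_. borel) (\<lambda>i \<omega>. g b (Ys i \<omega>, Xs i \<omega>)) {1..}"
        by (rule indep_vars_compose2[OF indep]) (use g[OF b] in simp)
      have "measure (distr M L D) (Pair b -` S) = prob {\<omega>\<in>space M. \<forall>i\<in>I. g b (Ys i \<omega>, Xs i \<omega>) \<in> A i}"
        using I b measurable_space[OF D] sets_Pair1[OF S, of b]
        by (subst measure_distr)
          (auto simp: S_def D_nth space_pair_measure subset_iff intro!: arg_cong[where f=prob])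
      \<comment> \<open>The independence rule requires a nonempty index set; for the empty one both
        sides are 1.\<close>
      also have "\<dots> = (\<Prod>i\<in>I. measure (distr Q borel (g b)) (A i))"
      proof (cases "I = {}")
        case False
        have "{\<omega>\<in>space M. \<forall>i\<in>I. g b (Ys i \<omega>, Xs i \<omega>) \<in> A i} =
            (\<Inter>i\<in>I. (\<lambda>\<omega>. g b (Ys i \<omega>, Xs i \<omega>)) -` A i \<inter> space M)"
          using False by auto
        also have "prob \<dots> = (\<Prod>i\<in>I. prob ((\<lambda>\<omega>. g b (Ys i \<omega>, Xs i \<omega>)) -` A i \<inter> space M))"
          by (rule indep_varsD[OF W False I(2,1)]) (rule A)
        also have "\<dots> = (\<Prod>i\<in>I. measure (distr Q borel (g b)) (A i))"
        proof (rule prod.cong[OF refl])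
          fix i assume i: "i \<in> I"
          then have "1 \<le> i" using I by auto
          then show "prob ((\<lambda>\<omega>. g b (Ys i \<omega>, Xs i \<omega>)) -` A i \<inter> space M) = measure (distr Q borel (g b)) (A i)"
            unfolding distr_g[OF \<open>1 \<le> i\<close> b, symmetric]
            using measurable_compose[OF pairs g[OF b]] A[OF i] by (subst measure_distr) auto
        qed
        finally show ?thesis .
      qed (simp add: prob_space)
      finally show ?thesis .
    qed
    show ?thesis
      using cond_prob_indep_rv[OF ind S] AE_space unfolding ev
      by eventually_elim (simp add: B_space section_prob)
  qed

  have cond_prob_Z1: "AE \<omega> in M. cond_prob M ?F {\<omega>\<in>space M. Z i \<omega> \<in> A} \<omega> =
      measure (distr Q borel (g (B \<omega>))) A" if "1 \<le> i" "A \<in> sets borel" for i A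
    using cond_prob_Z[of "{i}" "\<lambda>_. A"] that by simp

  have iid: "cond_iid M ?F {1..n} Z" for n
    unfolding cond_iid_def cond_indep_vars_def cond_ident_distr_def
  proof (intro conjI ballI allI impI; (elim conjE)?)
    fix i assume "i \<in> {1..n}"
    then show "Z i \<in> borel_measurable M" by simp
  next
    fix I A assume I: "I \<subseteq> {1..n}" "finite I" and A: "\<forall>i\<in>I. A i \<in> sets (borel :: real measure)"
    have "AE \<omega> in M. \<forall>i\<in>I. cond_prob M ?F {\<omega>\<in>space M. Z i \<omega> \<in> A i} \<omega> =
        measure (distr Q borel (g (B \<omega>))) (A i)"
      using I A by (intro AE_finite_allI cond_prob_Z1) auto
    moreover have "AE \<omega> in M. cond_prob M ?F {\<omega>\<in>space M. \<forall>i\<in>I. Z i \<omega> \<in> A i} \<omega> =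
        (\<Prod>i\<in>I. measure (distr Q borel (g (B \<omega>))) (A i))"
      using I A by (intro cond_prob_Z) auto
    ultimately show "AE \<omega> in M. cond_prob M ?F {\<omega>\<in>space M. \<forall>i\<in>I. Z i \<omega> \<in> A i} \<omega> =
        (\<Prod>i\<in>I. cond_prob M ?F {\<omega>\<in>space M. Z i \<omega> \<in> A i} \<omega>)"
      by eventually_elim simp
  next
    fix i j A assume "i \<in> {1..n}" "j \<in> {1..n}" "A \<in> sets (borel :: real measure)"
    then have "AE \<omega> in M. cond_prob M ?F {\<omega>\<in>space M. Z i \<omega> \<in> A} \<omega> = measure (distr Q borel (g (B \<omega>))) A"
      "AE \<omega> in M. cond_prob M ?F {\<omega>\<in>space M. Z j \<omega> \<in> A} \<omega> = measure (distr Q borel (g (B \<omega>))) A"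
      by (auto intro!: cond_prob_Z1)
    then show "AE \<omega> in M. cond_prob M ?F {\<omega>\<in>space M. Z i \<omega> \<in> A} \<omega> =
        cond_prob M ?F {\<omega>\<in>space M. Z j \<omega> \<in> A} \<omega>"
      by eventually_elim simp
  qed

  \<comment> \<open>An explicit conditional distribution\<close>
  have cond_distr_Z: "is_cond_distr M ?F (Z 1) (\<lambda>\<omega>. distr Q borel (g (B \<omega>)))"
    unfolding is_cond_distr_def
  proof (intro conjI ballI)
    have "(\<lambda>b. distr Q borel (g b)) \<in> measurable K (prob_algebra borel)"
      by (rule measurable_distr_prob_space2[where M=P])
        (use Q.prob_space_axioms sets_Q in \<open>auto simp: space_prob_algebra\<close>)
    from measurable_compose[OF measurable_sigma_gen[OF B] this]
    show "(\<lambda>\<omega>. distr Q borel (g (B \<omega>))) \<in> measurable ?F (prob_algebra borel)" .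
    fix A assume "A \<in> sets (borel :: real measure)"
    from cond_prob_Z1[OF order_refl this]
    show "AE \<omega> in M. measure (distr Q borel (g (B \<omega>))) A = cond_prob M ?F {\<omega>\<in>space M. Z 1 \<omega> \<in> A} \<omega>"
      by eventually_elim simp
  qed

  \<comment> \<open>Asymptotic normality: frozen statistics, then their mixture\<close>
  have clt: "weak_conv_m (\<lambda>n. distr M borel (T_ac c Z n)) std_normal_distribution"
    if var: "\<forall>i\<ge>1. AE \<omega> in M. 0 < cond_variance M ?F (Z i) \<omega> \<and> cond_variance M ?F (Z i) \<omega> < \<infinity>"
      and ac: "auto_calibrated M N \<mu> Y X"
  proof -
    define G where "G b i \<omega> = g b (Ys i \<omega>, Xs i \<omega>)" for b i \<omega>
    have G_meas[measurable]: "G b i \<in> borel_measurable M" if "b \<in> space K" "1 \<le> i" for b i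
      unfolding G_def[abs_def] using measurable_compose[OF pairs g] that by simp
    have T_meas[measurable]: "T_ac c (G b) n \<in> borel_measurable M" if "b \<in> space K" for b n
      using that by (intro T_ac_measurable) simp
    have G_clt: "weak_conv_m (\<lambda>n. distr M borel (T_ac c (G b) n)) std_normal_distribution"
      if b: "b \<in> space K"
        and pos: "0 < (\<integral>\<^sup>+z. ennreal ((z - (\<integral>u. u \<partial>distr Q borel (g b)))\<^sup>2) \<partial>distr Q borel (g b))"
        and fin: "(\<integral>\<^sup>+z. ennreal ((z - (\<integral>u. u \<partial>distr Q borel (g b)))\<^sup>2) \<partial>distr Q borel (g b)) < \<infinity>"
      for b
    proof -
      let ?\<nu> = "distr Q borel (g b)"
      have gQ[measurable]: "g b \<in> borel_measurable Q" using g[OF b] by (simp cong: measurable_cong_sets add: sets_Q)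
      interpret \<nu>: prob_space ?\<nu> by (rule Q.prob_space_distr) simp
      \<comment> \<open>The order matters: the finite centred integral first yields a second moment,
        hence integrability. Only then does auto-calibration give mean 0, which turns
        \<open>pos\<close> into a positive second moment.\<close>
      have sq: "integrable ?\<nu> (\<lambda>x. x\<^sup>2)"
        by (rule \<nu>.square_integrable_of_finite_centered_moment[OF _ fin]) simp
      have "integrable ?\<nu> (\<lambda>x. x)"
        by (rule \<nu>.square_integrable_imp_integrable[OF _ sq]) simp
      then have "integrable M (\<lambda>\<omega>. g b (Y \<omega>, X \<omega>))"
        using g[OF b] by (simp add: integrable_distr_eq Q_def)
      moreover have "h b \<in> borel_measurable (restrict_space borel (\<mu> ` space N))"
        using measurable_Pair2[OF \<open>(\<lambda>(b, m). h b m) \<in> borel_measurable _\<close>, of b] b by (simp add: K_def)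
      moreover have "integrable M Y"
        by (rule square_integrable_imp_integrable[OF Y])
      ultimately have "(\<integral>\<omega>. g b (Y \<omega>, X \<omega>) \<partial>M) = 0"
        unfolding g_def fst_conv snd_conv
        by (intro auto_calibrated_integral_eq_0[OF \<open>X \<in> measurable M N\<close> _ ac])
      then have mean: "(\<integral>x. x \<partial>?\<nu>) = 0"
        using g[OF b] by (simp add: integral_distr Q_def)
      have "(\<integral>\<^sup>+z. ennreal (z\<^sup>2) \<partial>?\<nu>) = ennreal (\<integral>z. z\<^sup>2 \<partial>?\<nu>)"
        by (rule nn_integral_eq_integral[OF sq]) simp
      with pos have "0 < (\<integral>x. x\<^sup>2 \<partial>?\<nu>)" by (simp add: mean)
      with sq mean show ?thesis
        using distr_g[OF _ b] unfolding G_def[abs_def]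
        by (intro central_limit_theorem_studentized[where \<nu>="?\<nu>"] indep_vars_compose2[OF indep] g b) auto
    qed
    have G_AE: "AE \<omega> in M. weak_conv_m (\<lambda>n. distr M borel (T_ac c (G (B \<omega>)) n)) std_normal_distribution"
    proof -
      have "AE \<omega> in M. 0 < cond_variance M ?F (Z 1) \<omega> \<and> cond_variance M ?F (Z 1) \<omega> < \<infinity>"
        using var by simp
      then show ?thesis
        using AE_cond_distr_eq[OF F.subalg cond_distr_Z] AE_space
        by eventually_elim (rule G_clt, auto simp: cond_variance_def B_space)
    qed
    \<comment> \<open>In the integrand the outer outcome fixes only the value of \<open>B\<close>;
      the inner law is over the test data with that value frozen.\<close>
    have mixture: "cdf (distr M borel (T_ac c Z n)) x = (\<integral>\<omega>. cdf (distr M borel (T_ac c (G (B \<omega>)) n)) x \<partial>M)"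
      and mix_meas: "(\<lambda>\<omega>. cdf (distr M borel (T_ac c (G (B \<omega>)) n)) x) \<in> borel_measurable M" for n x
    proof -
      define \<tau> where "\<tau> = T_ac c (\<lambda>i p. g (fst p) (snd p i)) n"
      have [measurable]: "\<tau> \<in> borel_measurable (K \<Otimes>\<^sub>M L)"
        unfolding \<tau>_def
      proof (rule T_ac_measurable)
        fix i assume "i \<in> {1..n}"
        then have "1 \<le> i" by simp
        from coord[OF this] have "(\<lambda>p. (fst p, snd p i)) \<in> measurable (K \<Otimes>\<^sub>M L) (K \<Otimes>\<^sub>M P)"
          by measurable
        from measurable_compose[OF this g_pair]
        show "(\<lambda>p. g (fst p) (snd p i)) \<in> borel_measurable (K \<Otimes>\<^sub>M L)" by simp
      qed
      define S where "S = {p \<in> space (K \<Otimes>\<^sub>M L). \<tau> p \<le> x}"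
      have S: "S \<in> sets (K \<Otimes>\<^sub>M L)" unfolding S_def by measurable
      \<comment> \<open>The statistic reads only indices from 1 to \<open>n\<close>, where
        \<open>D\<close> carries the test pairs; outside its index set \<open>D\<close> is
        undefined.\<close>
      have \<tau>: "\<tau> (b, D \<omega>) = T_ac c (G b) n \<omega>" for b \<omega>
        unfolding \<tau>_def by (rule T_ac_cong) (simp add: G_def D_nth)
      have T_Z: "T_ac c (G (B \<omega>)) n \<omega> = T_ac c Z n \<omega>" for \<omega>
        by (rule T_ac_cong) (simp add: G_def Z_eq)
      have cdf_eq: "cdf (distr M borel V) x = prob {\<omega>\<in>space M. V \<omega> \<le> x}"
        if "V \<in> borel_measurable M" for V
        unfolding cdf_def using that by (simp add: measure_distr vimage_def Collect_conj_eq Int_commute)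
      have sec: "measure (distr M L D) (Pair (B \<omega>) -` S) = cdf (distr M borel (T_ac c (G (B \<omega>)) n)) x"
        if "\<omega> \<in> space M" for \<omega>
        using B_space[OF that] measurable_space[OF D] sets_Pair1[OF S, of "B \<omega>"]
        by (subst measure_distr, simp_all add: cdf_eq)
          (auto simp: S_def space_pair_measure \<tau> intro!: arg_cong[where f=prob])
      have "T_ac c Z n \<in> borel_measurable M" by (rule T_ac_measurable) simp
      then have "cdf (distr M borel (T_ac c Z n)) x = prob {\<omega>\<in>space M. (B \<omega>, D \<omega>) \<in> S}"
        using B_space measurable_space[OF D]
        by (auto simp: cdf_eq S_def space_pair_measure \<tau> T_Z intro!: arg_cong[where f=prob])
      also have "\<dots> = (\<integral>\<omega>. measure (distr M L D) (Pair (B \<omega>) -` S) \<partial>M)"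
        by (rule prob_indep_rv[OF ind S])
      also have "\<dots> = (\<integral>\<omega>. cdf (distr M borel (T_ac c (G (B \<omega>)) n)) x \<partial>M)"
        by (intro Bochner_Integration.integral_cong sec refl)
      finally show "cdf (distr M borel (T_ac c Z n)) x = (\<integral>\<omega>. cdf (distr M borel (T_ac c (G (B \<omega>)) n)) x \<partial>M)" .
      show "(\<lambda>\<omega>. cdf (distr M borel (T_ac c (G (B \<omega>)) n)) x) \<in> borel_measurable M"
        using measurable_compose[OF B measurable_prob_section[OF D S]] sec by (simp cong: measurable_cong)
    qed
    show ?thesis
      unfolding weak_conv_m_def weak_conv_def
    proof (intro allI impI)
      fix x
      let ?\<Phi> = "cdf std_normal_distribution x"
      \<comment> \<open>The limit is constant in \<omega>, so its integral over a probability space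
        is the constant itself; distribution functions are dominated by 1.\<close>
      have "(\<lambda>n. \<integral>\<omega>. cdf (distr M borel (T_ac c (G (B \<omega>)) n)) x \<partial>M) \<longlonglongrightarrow> (\<integral>\<omega>. ?\<Phi> \<partial>M)"
      proof (rule integral_dominated_convergence[where w="\<lambda>_. 1"])
        show "AE \<omega> in M. (\<lambda>n. cdf (distr M borel (T_ac c (G (B \<omega>)) n)) x) \<longlonglongrightarrow> ?\<Phi>"
          using G_AE isCont_cdf_std_normal[of x]
          unfolding weak_conv_m_def weak_conv_def by (auto elim: eventually_mono)
        show "AE \<omega> in M. norm (cdf (distr M borel (T_ac c (G (B \<omega>)) n)) x) \<le> 1" for n
          using AE_space
        proof eventually_elim
          case (elim \<omega>)
          interpret T: real_distribution "distr M borel (T_ac c (G (B \<omega>)) n)"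
            using B_space[OF elim] by simp
          show ?case using T.cdf_bounded_prob[of x] T.cdf_nonneg[of x] by simp
        qed
      qed (use mix_meas in simp_all)
      then show "(\<lambda>n. cdf (distr M borel (T_ac c Z n)) x) \<longlonglongrightarrow> ?\<Phi>"
        by (simp add: mixture prob_space)
    qed
  qed
  show ?thesis
    using iid clt unfolding K_def by blast
qed

end
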